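(* Let $\mathcal{C}_1,\dots,\mathcal{C}_N$ be disjoint clusters of devices, with lead device $k_n\in\mathcal{C}_n$, and let $\tilde k_n$ denote a generic subordinate device of cluster $n$, i.e. $\tilde k_n\in\mathcal{C}_n\setminus\{k_n\}$; all sums over $\tilde k_n\in\mathcal{C}_n$ below are over subordinate devices. Let $c_1,c_2>0$, $\zeta>0$, $\nu>0$, transmit powers $\alpha_{\tilde k_n}\ge 0$, channel magnitudes $\bar h_{k_n}>0$, $\bar h_{\tilde k_n,k_n}>0$, noise variances $\sigma_{k_n}^2>0$ and power budgets $P_{k_n}^{\max}$ be given, and put $$\hat P_{k_n}^{\max}=\frac{P_{k_n}^{\max}}{\sum_{\tilde k_n\in\mathcal{C}_n}\bar h_{\tilde k_n,k_n}^2\alpha_{\tilde k_n}+\sigma_{k_n}^2}.$$ Consider the problem over $\beta_{k_n}\ge0$, $n=1,\dots,N$: $$\min_{\{\beta_{k_n}\}}\ c_1\sum_{n=1}^N\sum_{\tilde k_n\in\mathcal{C}_n}\left(\zeta\bar h_{k_n}\sqrt{\beta_{k_n}}\,\bar h_{\tilde k_n,k_n}\sqrt{\alpha_{\tilde k_n}}-1\right)^2+c_2\sum_{n=1}^N\zeta^2\nu^2\bar h_{k_n}^2\beta_{k_n}\sigma_{k_n}^2\quad\text{subject to}\quad \beta_{k_n}\le\hat P_{k_n}^{\max},\ \forall n.$$ Then the optimal solution is $$\beta_{k_n}^{\rm opt}=\min\left[\left(\frac{c_1\zeta\bar h_{k_n}\sum_{\tilde k_n\in\mathcal{C}_n}\bar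 h_{\tilde k_n,k_n}\sqrt{\alpha_{\tilde k_n}}}{c_1\zeta^2\bar h_{k_n}^2\sum_{\tilde k_n\in\mathcal{C}_n}\bar h_{\tilde k_n,k_n}^2\alpha_{\tilde k_n}+c_2\zeta^2\nu^2\bar h_{k_n}^2\sigma_{k_n}^2}\right)^2,\ \hat P_{k_n}^{\max}\right],\qquad \forall n.$$
   Context: The problem arises in a two-tier over-the-air federated learning system with $K$ devices $\mathcal{K}$ partitioned into $N$ clusters: subordinate device $\tilde k_n$ transmits to its lead device $k_n$ with power $\alpha_{\tilde k_n}$ over a channel of magnitude $\bar h_{\tilde k_n,k_n}$; lead device $k_n$ (receiver noise variance $\sigma_{k_n}^2$) forwards to the parameter server with power coefficient $\beta_{k_n}$ over a channel of magnitude $\bar h_{k_n}$; $\zeta$ is the de-noising factor at the server and $\nu$ the gradient normalization factor. $P_{k}^{\max}\ge 0$ is the maximum power budget of device $k$. In the paper $c_1=\frac{(A+B)\sum_{k\in\mathcal{K}}\|\Delta\mathbf{g}_k\|_2^2}{K^2}$ and $c_2=\frac{MB}{K^2}$, where $\Delta\mathbf{g}_k$ are centred local gradient vectors, $M$ is the model dimension and $A,B>0$ are constants; all that matters here is that $c_1,c_2$ do not depend on the optimization variables. "Optimal solution" means a feasible minimizer of the stated problem. *)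

theory Defs
  imports Complex_Main "HOL-Library.Disjoint_Sets"
begin

definition subordinates :: "(nat \<Rightarrow> 'd set) \<Rightarrow> (nat \<Rightarrow> 'd) \<Rightarrow> nat \<Rightarrow> 'd set" where
  "subordinates C lead n = C n - {lead n}"

text \<open>
  Channels: \<^term>\<open>h_dev i k\<close> is the magnitude from subordinate device \<^term>\<open>i\<close> to lead
  device \<^term>\<open>k\<close>, and \<^term>\<open>h_srv k\<close> the one from lead device \<^term>\<open>k\<close> to the parameter server.
  The noise variance at \<^term>\<open>k\<close> is \<^term>\<open>(\<sigma> k)\<^sup>2\<close> for \<^term>\<open>\<sigma> :: 'd \<Rightarrow> real\<close>.
\<close>

definition P_hat ::
  "(nat \<Rightarrow> 'd set) \<Rightarrow> (nat \<Rightarrow> 'd) \<Rightarrow> ('d \<Rightarrow> real) \<Rightarrow> ('d \<Rightarrow> 'd \<Rightarrow> real) \<Rightarrow> ('d \<Rightarrow> real)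
    \<Rightarrow> ('d \<Rightarrow> real) \<Rightarrow> nat \<Rightarrow> real" where
  "P_hat C lead P_max h_dev \<alpha> \<sigma> n =
     P_max (lead n) /
       ((\<Sum>i\<in>subordinates C lead n. (h_dev i (lead n))\<^sup>2 * \<alpha> i) + (\<sigma> (lead n))\<^sup>2)"

text \<open>
  The power coefficients \<^term>\<open>\<beta> :: 'd \<Rightarrow> real\<close> are indexed by devices, but the problem only
  involves their values at the lead devices \<^term>\<open>lead n\<close>, \<^term>\<open>n \<in> {1..N}\<close>.
\<close>

definition objective ::
  "nat \<Rightarrow> (nat \<Rightarrow> 'd set) \<Rightarrow> (nat \<Rightarrow> 'd) \<Rightarrow> real \<Rightarrow> real \<Rightarrow> real \<Rightarrow> real
    \<Rightarrow> ('d \<Rightarrow> real) \<Rightarrow> ('d \<Rightarrow> 'd \<Rightarrow> real) \<Rightarrow> ('d \<Rightarrow> real) \<Rightarrow> ('d \<Rightarrow> real) \<Rightarrow> ('d \<Rightarrow> real) \<Rightarrow> real" where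
  "objective N C lead c1 c2 \<zeta> \<nu> h_srv h_dev \<alpha> \<sigma> \<beta> =
     c1 * (\<Sum>n=1..N. \<Sum>i\<in>subordinates C lead n.
             (\<zeta> * h_srv (lead n) * sqrt (\<beta> (lead n)) * h_dev i (lead n) * sqrt (\<alpha> i) - 1)\<^sup>2)
     + c2 * (\<Sum>n=1..N. \<zeta>\<^sup>2 * \<nu>\<^sup>2 * (h_srv (lead n))\<^sup>2 * \<beta> (lead n) * (\<sigma> (lead n))\<^sup>2)"

definition feasible ::
  "nat \<Rightarrow> (nat \<Rightarrow> 'd set) \<Rightarrow> (nat \<Rightarrow> 'd) \<Rightarrow> ('d \<Rightarrow> real) \<Rightarrow> ('d \<Rightarrow> 'd \<Rightarrow> real) \<Rightarrow> ('d \<Rightarrow> real)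
    \<Rightarrow> ('d \<Rightarrow> real) \<Rightarrow> ('d \<Rightarrow> real) \<Rightarrow> bool" where
  "feasible N C lead P_max h_dev \<alpha> \<sigma> \<beta> \<longleftrightarrow>
     (\<forall>n\<in>{1..N}. 0 \<le> \<beta> (lead n) \<and> \<beta> (lead n) \<le> P_hat C lead P_max h_dev \<alpha> \<sigma> n)"

end

(* The objective is a sum of one function per cluster, and since the leads are distinct the problem
   decouples. In x = sqrt b the cluster objective is the quadratic D x^2 - 2 E x + F with D > 0 and
   E >= 0, whose unique minimizer on [0, sqrt P] is its vertex E / D truncated at sqrt P. *)

theory Submission
  imports Defs
begin

lemma is_arg_min_separable_iff:
  fixes f :: "'i \<Rightarrow> 'b \<Rightarrow> real" and l :: "'i \<Rightarrow> 'a"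
  assumes "finite I" and "inj_on l I"
    and mem: "\<And>n. n \<in> I \<Longrightarrow> b n \<in> S n"
    and less: "\<And>n x. n \<in> I \<Longrightarrow> x \<in> S n \<Longrightarrow> x \<noteq> b n \<Longrightarrow> f n (b n) < f n x"
  shows "is_arg_min (\<lambda>\<beta>. \<Sum>n\<in>I. f n (\<beta> (l n))) (\<lambda>\<beta>. \<forall>n\<in>I. \<beta> (l n) \<in> S n) \<beta>
    \<longleftrightarrow> (\<forall>n\<in>I. \<beta> (l n) = b n)"
proof
  assume min: "is_arg_min (\<lambda>\<beta>. \<Sum>n\<in>I. f n (\<beta> (l n))) (\<lambda>\<beta>. \<forall>n\<in>I. \<beta> (l n) \<in> S n) \<beta>"
  \<comment> \<open>The competitor attaining all termwise minima: \<open>b\<close> carried from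
    indices to the points \<open>l n\<close>.\<close>
  define \<gamma> where "\<gamma> = b \<circ> inv_into I l"
  have \<gamma>: "\<gamma> (l n) = b n" if "n \<in> I" for n
    using that assms(2) by (simp add: \<gamma>_def)
  have le: "f n (b n) \<le> f n (\<beta> (l n))" if "n \<in> I" for n
    using min less[OF that, of "\<beta> (l n)"] that
    by (cases "\<beta> (l n) = b n") (auto simp: is_arg_min_def intro: less_imp_le)
  show "\<forall>n\<in>I. \<beta> (l n) = b n"
  proof (rule ccontr)
    assume "\<not> (\<forall>n\<in>I. \<beta> (l n) = b n)"
    then have "\<exists>n\<in>I. f n (b n) < f n (\<beta> (l n))"
      using min less by (auto simp: is_arg_min_def)
    then have "(\<Sum>n\<in>I. f n (b n)) < (\<Sum>n\<in>I. f n (\<beta> (l n)))"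
      using assms(1) le by (intro sum_strict_mono_ex1) auto
    then have "(\<Sum>n\<in>I. f n (\<gamma> (l n))) < (\<Sum>n\<in>I. f n (\<beta> (l n)))"
      using \<gamma> by simp
    moreover have "\<forall>n\<in>I. \<gamma> (l n) \<in> S n"
      using \<gamma> mem by simp
    ultimately show False
      using min unfolding is_arg_min_def by blast
  qed
next
  assume eq: "\<forall>n\<in>I. \<beta> (l n) = b n"
  have "(\<Sum>n\<in>I. f n (\<beta> (l n))) \<le> (\<Sum>n\<in>I. f n (\<gamma> (l n)))"
    if "\<forall>n\<in>I. \<gamma> (l n) \<in> S n" for \<gamma>
  proof (rule sum_mono)
    fix n assume "n \<in> I"
    then show "f n (\<beta> (l n)) \<le> f n (\<gamma> (l n))"
      using eq that less[of n "\<gamma> (l n)"] by (cases "\<gamma> (l n) = b n") auto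
  qed
  then show "is_arg_min (\<lambda>\<beta>. \<Sum>n\<in>I. f n (\<beta> (l n))) (\<lambda>\<beta>. \<forall>n\<in>I. \<beta> (l n) \<in> S n) \<beta>"
    using eq mem unfolding is_arg_min_def not_ex de_Morgan_conj not_less by fastforce
qed

text \<open>First-order optimality plus strict convexity: moving from the truncated vertex to any
  admissible point cannot decrease the linear part, and the quadratic remainder is strictly
  positive.\<close>

lemma truncated_vertex_less:
  fixes D E P x :: real
  assumes "D > 0" and "x \<le> P" and "x \<noteq> min (E / D) P"
  shows "D * (min (E / D) P)\<^sup>2 - 2 * E * min (E / D) P < D * x\<^sup>2 - 2 * E * x"
proof -
  define m where "m = min (E / D) P"
  \<comment> \<open>\<open>2 * (D * m - E)\<close> is the derivative at \<open>m\<close>. It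
    vanishes at the vertex; if the bound \<open>P\<close> is active it is nonpositive, and so is
    \<open>x - m\<close>.\<close>
  have "(x - m) * (D * m - E) \<ge> 0"
  proof (cases "E / D \<le> P")
    case True
    then show ?thesis using assms(1) by (simp add: m_def)
  next
    case False
    then have "m = P" "D * P \<le> E"
      using assms(1) by (auto simp: m_def field_simps)
    then show ?thesis
      using assms(2) by (intro mult_nonpos_nonpos) auto
  qed
  moreover have "D * (x - m)\<^sup>2 > 0"
    using assms by (simp add: m_def)
  \<comment> \<open>Exact Taylor expansion of the quadratic about \<open>m\<close>.\<close>
  moreover have "D * x\<^sup>2 - 2 * E * x - (D * m\<^sup>2 - 2 * E * m)
      = D * (x - m)\<^sup>2 + 2 * ((x - m) * (D * m - E))"
    by (simp add: power2_eq_square algebra_simps)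
  ultimately show ?thesis
    unfolding m_def by linarith
qed

text \<open>The previous bound in the variable \<open>sqrt b\<close>, in which the cap
  \<open>P\<close> becomes \<open>sqrt P\<close>.\<close>

lemma truncated_vertex_sqrt_less:
  fixes D E F P b :: real
  assumes "D > 0" and "E \<ge> 0" and "0 \<le> b" and "b \<le> P" and ne: "b \<noteq> min ((E / D)\<^sup>2) P"
  shows "D * min ((E / D)\<^sup>2) P - 2 * E * sqrt (min ((E / D)\<^sup>2) P) + F
    < D * b - 2 * E * sqrt b + F"
proof -
  \<comment> \<open>Monotonicity moves \<open>sqrt\<close> inside \<open>min\<close>;
    \<open>E \<ge> 0\<close> makes the root of the square \<open>E / D\<close> itself, not its
    negative.\<close>
  have sqrt_min: "sqrt (min ((E / D)\<^sup>2) P) = min (E / D) (sqrt P)"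
    using assms(1,2) by (simp add: min_of_mono[OF monoI, symmetric])
  have nonneg: "0 \<le> min ((E / D)\<^sup>2) P"
    using assms by simp
  have "sqrt b \<noteq> min (E / D) (sqrt P)"
    using ne unfolding sqrt_min[symmetric] by simp
  then have "D * (min (E / D) (sqrt P))\<^sup>2 - 2 * E * min (E / D) (sqrt P)
      < D * (sqrt b)\<^sup>2 - 2 * E * sqrt b"
    using assms by (intro truncated_vertex_less) auto
  then show ?thesis
    using nonneg assms(3) unfolding sqrt_min[symmetric] by simp
qed

text \<open>Brings a cluster's error term into the form of a quadratic in \<open>sqrt x\<close>;
  nonnegativity of \<open>x\<close> and \<open>v i\<close> lets the squared roots cancel.\<close>

lemma sum_square_affine:
  fixes a x :: real and u v :: "'i \<Rightarrow> real"
  assumes "\<And>i. i \<in> A \<Longrightarrow> v i \<ge> 0" and "x \<ge> 0"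
  shows "(\<Sum>i\<in>A. (a * sqrt x * u i * sqrt (v i) - 1)\<^sup>2)
    = a\<^sup>2 * (\<Sum>i\<in>A. (u i)\<^sup>2 * v i) * x - 2 * a * (\<Sum>i\<in>A. u i * sqrt (v i)) * sqrt x + card A"
proof -
  have "(\<Sum>i\<in>A. (a * sqrt x * u i * sqrt (v i) - 1)\<^sup>2)
    = (\<Sum>i\<in>A. a\<^sup>2 * x * ((u i)\<^sup>2 * v i) - 2 * a * sqrt x * (u i * sqrt (v i)) + 1)"
    using assms by (intro sum.cong) (simp_all add: power2_diff power_mult_distrib)
  also have "\<dots> = a\<^sup>2 * x * (\<Sum>i\<in>A. (u i)\<^sup>2 * v i) - 2 * a * sqrt x * (\<Sum>i\<in>A. u i * sqrt (v i)) + card A"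
    by (simp only: sum.distrib sum_subtractf sum_distrib_left) simp
  finally show ?thesis
    by (simp add: mult_ac)
qed

text \<open>Existence is stated besides the characterization because prescribing values at the lead
  devices is consistent only if these are distinct.\<close>

theorem proposition2:
  fixes N :: nat
    and C :: "nat \<Rightarrow> 'd set" and lead :: "nat \<Rightarrow> 'd"
    and c1 c2 \<zeta> \<nu> :: real
    and \<alpha> h_srv \<sigma> P_max :: "'d \<Rightarrow> real"
    and h_dev :: "'d \<Rightarrow> 'd \<Rightarrow> real"
  assumes "disjoint_family_on C {1..N}"
    and "\<And>n. n \<in> {1..N} \<Longrightarrow> finite (C n)"
    and "\<And>n. n \<in> {1..N} \<Longrightarrow> lead n \<in> C n"
    and "c1 > 0" and "c2 > 0" and "\<zeta> > 0" and "\<nu> > 0"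
    and "\<And>n i. n \<in> {1..N} \<Longrightarrow> i \<in> subordinates C lead n \<Longrightarrow> \<alpha> i \<ge> 0"
    and "\<And>n. n \<in> {1..N} \<Longrightarrow> h_srv (lead n) > 0"
    and "\<And>n i. n \<in> {1..N} \<Longrightarrow> i \<in> subordinates C lead n \<Longrightarrow> h_dev i (lead n) > 0"
    and "\<And>n. n \<in> {1..N} \<Longrightarrow> (\<sigma> (lead n))\<^sup>2 > 0"
    and "\<And>n. n \<in> {1..N} \<Longrightarrow> P_max (lead n) \<ge> 0"
  shows "(\<exists>\<beta>. is_arg_min (objective N C lead c1 c2 \<zeta> \<nu> h_srv h_dev \<alpha> \<sigma>)
                (feasible N C lead P_max h_dev \<alpha> \<sigma>) \<beta>) \<and>
    (\<forall>\<beta>. is_arg_min (objective N C lead c1 c2 \<zeta> \<nu> h_srv h_dev \<alpha> \<sigma>)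
           (feasible N C lead P_max h_dev \<alpha> \<sigma>) \<beta> \<longleftrightarrow>
      (\<forall>n\<in>{1..N}. \<beta> (lead n) =
         min ((c1 * \<zeta> * h_srv (lead n) *
                 (\<Sum>i\<in>subordinates C lead n. h_dev i (lead n) * sqrt (\<alpha> i)) /
               (c1 * \<zeta>\<^sup>2 * (h_srv (lead n))\<^sup>2 *
                 (\<Sum>i\<in>subordinates C lead n. (h_dev i (lead n))\<^sup>2 * \<alpha> i)
                + c2 * \<zeta>\<^sup>2 * \<nu>\<^sup>2 * (h_srv (lead n))\<^sup>2 * (\<sigma> (lead n))\<^sup>2))\<^sup>2)
             (P_hat C lead P_max h_dev \<alpha> \<sigma> n)))"
proof -
  \<comment> \<open>\<open>D n\<close> and \<open>- 2 * E n\<close> are the coefficients of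
    \<open>x\<close> and \<open>sqrt x\<close> in the cluster objective \<open>f n x\<close>; the
    noise term is linear in \<open>x\<close> and joins \<open>D n\<close>.\<close>
  define D where "D n = c1 * \<zeta>\<^sup>2 * (h_srv (lead n))\<^sup>2 *
      (\<Sum>i\<in>subordinates C lead n. (h_dev i (lead n))\<^sup>2 * \<alpha> i)
    + c2 * \<zeta>\<^sup>2 * \<nu>\<^sup>2 * (h_srv (lead n))\<^sup>2 * (\<sigma> (lead n))\<^sup>2" for n
  define E where "E n = c1 * \<zeta> * h_srv (lead n) *
      (\<Sum>i\<in>subordinates C lead n. h_dev i (lead n) * sqrt (\<alpha> i))" for n
  define f where "f n x = c1 * (\<Sum>i\<in>subordinates C lead n.
        (\<zeta> * h_srv (lead n) * sqrt x * h_dev i (lead n) * sqrt (\<alpha> i) - 1)\<^sup>2)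
      + c2 * (\<zeta>\<^sup>2 * \<nu>\<^sup>2 * (h_srv (lead n))\<^sup>2 * x * (\<sigma> (lead n))\<^sup>2)" for n x
  define P where "P = P_hat C lead P_max h_dev \<alpha> \<sigma>"
  define b where "b n = min ((E n / D n)\<^sup>2) (P n)" for n
  \<comment> \<open>A lead shared by two clusters would lie in their empty intersection.\<close>
  have inj: "inj_on lead {1..N}"
    using assms(1,3) unfolding inj_on_def disjoint_family_on_def by (metis disjoint_iff)
  \<comment> \<open>Strictness comes from the noise term: the sum over subordinates may
    vanish.\<close>
  have D_pos: "D n > 0" if n: "n \<in> {1..N}" for n
  proof -
    have "(\<Sum>i\<in>subordinates C lead n. (h_dev i (lead n))\<^sup>2 * \<alpha> i) \<ge> 0"
      using assms(8) n by (intro sum_nonneg) simp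
    moreover have "c2 * \<zeta>\<^sup>2 * \<nu>\<^sup>2 * (h_srv (lead n))\<^sup>2 * (\<sigma> (lead n))\<^sup>2 > 0"
      using assms(5-7) assms(9,11)[OF n] by (intro mult_pos_pos) simp_all
    ultimately show ?thesis
      unfolding D_def using assms(4) by (intro add_nonneg_pos mult_nonneg_nonneg) simp_all
  qed
  have E_nonneg: "E n \<ge> 0" if n: "n \<in> {1..N}" for n
    unfolding E_def using assms(4,6) assms(8,9,10)[OF n]
    by (intro mult_nonneg_nonneg sum_nonneg) (auto intro: less_imp_le)
  \<comment> \<open>Nonnegative budgets make each interval \<open>{0..P n}\<close> nonempty, so that
    it contains \<open>b n\<close>.\<close>
  have P_nonneg: "P n \<ge> 0" if n: "n \<in> {1..N}" for n
    unfolding P_def P_hat_def using assms(8,12) n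
    by (intro divide_nonneg_nonneg add_nonneg_nonneg sum_nonneg) simp_all
  have b_mem: "b n \<in> {0..P n}" if "n \<in> {1..N}" for n
    using P_nonneg[OF that] by (simp add: b_def)
  have f_eq: "f n x = D n * x - 2 * E n * sqrt x + c1 * card (subordinates C lead n)"
    if n: "n \<in> {1..N}" and x: "x \<ge> 0" for n x
    unfolding f_def D_def E_def
    by (subst sum_square_affine[OF assms(8)[OF n] x]) (simp_all add: algebra_simps power2_eq_square)
  have less: "f n (b n) < f n x" if "n \<in> {1..N}" "x \<in> {0..P n}" "x \<noteq> b n" for n x
    using truncated_vertex_sqrt_less[OF D_pos E_nonneg, of n n x "P n"] that b_mem[of n]
    by (simp add: f_eq b_def)
  have obj: "objective N C lead c1 c2 \<zeta> \<nu> h_srv h_dev \<alpha> \<sigma> = (\<lambda>\<beta>. \<Sum>n=1..N. f n (\<beta> (lead n)))"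
    by (simp add: fun_eq_iff objective_def f_def sum.distrib sum_distrib_left)
  have feas: "feasible N C lead P_max h_dev \<alpha> \<sigma> = (\<lambda>\<beta>. \<forall>n\<in>{1..N}. \<beta> (lead n) \<in> {0..P n})"
    by (simp add: fun_eq_iff feasible_def P_def)
  have iff: "is_arg_min (objective N C lead c1 c2 \<zeta> \<nu> h_srv h_dev \<alpha> \<sigma>)
      (feasible N C lead P_max h_dev \<alpha> \<sigma>) \<beta> \<longleftrightarrow> (\<forall>n\<in>{1..N}. \<beta> (lead n) = b n)" for \<beta>
    unfolding obj feas
    by (rule is_arg_min_separable_iff[where S = "\<lambda>n. {0..P n}"]) (use inj b_mem less in auto)
  \<comment> \<open>The witness for existence, well defined at the leads by their
    distinctness.\<close>
  have "\<forall>n\<in>{1..N}. (b \<circ> inv_into {1..N} lead) (lead n) = b n"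
    using inj by simp
  then show ?thesis
    using iff unfolding b_def D_def E_def P_def by blast
qed

end
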